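(* Let $(G,\theta)$ be a measured group and let $(X,\mu)$ be an ergodic stationary $(G,\theta)$-space. Then either $\mu$ is $G$-invariant (the action is probability preserving), or the action is of type $\mathrm{III}$, i.e. there is no nonzero $\sigma$-finite Borel measure $m$ on $X$ that is $G$-invariant and absolutely continuous with respect to $\mu$.
   Context: A measured group $(G,\theta)$ is a locally compact second countable (lcsc) group $G$ with an admissible Borel probability measure $\theta$, i.e. $\theta$ is absolutely continuous with respect to Haar measure and is not supported on a closed proper subsemigroup of $G$ (equivalently $G=\overline{\bigcup_{n\ge1}\mathrm{supp}(\theta^{\ast n})}$). A Borel $G$-space is a standard Borel space $X$ with a Borel action map $G\times X\to X$, $(g,x)\mapsto g.x$. For a measure $\mu$ on $X$, $g\mu(A):=\mu(g^{-1}.A)$. A stationary $(G,\theta)$-space is a Borel $G$-space $X$ with a Borel probability measure $\mu$ such that $\theta\ast\mu=\mu$, where $\theta\ast\mu(A)=\int_G g\mu(A)\,d\theta(g)$. (Such a $\mu$ is automatically quasi-invariant, i.e. $g\mu\sim\mu$ for all $g$.) It is ergodic if every measurable $f:X\to\mathbb{R}$ such that for each $g\in G$ one has $f(g.x)=f(x)$ for $\mu$-a.e. $x$, is constant $\mu$-a.e. *)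

theory Defs
  imports "HOL-Probability.Probability"
begin

text \<open>
  Groups are written additively because the library's class of topological groups,
  \<^class>\<open>topological_group_add\<close>, is additive; it does not assume commutativity.
\<close>

text \<open>
  Left Haar measures: nonzero left-invariant Radon measures. Left and right Haar measures
  have the same null sets.
\<close>

definition haar_measure :: "'g::{topological_group_add, t2_space} measure \<Rightarrow> bool" where
  "haar_measure \<nu> \<longleftrightarrow>
     sets \<nu> = sets borel \<and>
     emeasure \<nu> UNIV \<noteq> 0 \<and>
     (\<forall>g. \<forall>A\<in>sets borel. emeasure \<nu> ((+) g ` A) = emeasure \<nu> A) \<and>
     (\<forall>K. compact K \<longrightarrow> emeasure \<nu> K < \<infinity>) \<and>
     (\<forall>A\<in>sets borel. emeasure \<nu> A = (INF U\<in>{U. open U \<and> A \<subseteq> U}. emeasure \<nu> U)) \<and>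
     (\<forall>U. open U \<longrightarrow> emeasure \<nu> U = (SUP K\<in>{K. compact K \<and> K \<subseteq> U}. emeasure \<nu> K))"

definition subsemigroup :: "'g::semigroup_add set \<Rightarrow> bool" where
  "subsemigroup S \<longleftrightarrow> (\<forall>g\<in>S. \<forall>h\<in>S. g + h \<in> S)"

locale measured_group = prob_space \<theta>
  for \<theta> :: "'g::{topological_group_add, second_countable_topology, t2_space} measure" +
  assumes locally_compact: "locally_compact_space (euclidean :: 'g topology)"
    and sets_borel: "sets \<theta> = sets borel"
    and abs_cont_haar: "\<exists>\<nu>. haar_measure \<nu> \<and> absolutely_continuous \<nu> \<theta>"
    and not_supported_on_proper_subsemigroup:
      "\<not> (\<exists>S. closed S \<and> subsemigroup S \<and> S \<noteq> UNIV \<and> (AE g in \<theta>. g \<in> S))"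

definition standard_borel :: "'x measure \<Rightarrow> bool" where
  "standard_borel M \<longleftrightarrow>
     (\<exists>T. topspace T = space M \<and> completely_metrizable_space T \<and> second_countable T \<and>
          sets M = sigma_sets (space M) {U. openin T U})"

text \<open>Only the underlying measurable space of \<open>M\<close> matters in the next locale.\<close>

locale borel_G_space =
  fixes M :: "'x measure"
    and act :: "'g::{topological_group_add, second_countable_topology, t2_space} \<Rightarrow> 'x \<Rightarrow> 'x"
  assumes standard_borel: "standard_borel M"
    and act_measurable: "(\<lambda>(g, x). act g x) \<in> borel \<Otimes>\<^sub>M M \<rightarrow>\<^sub>M M"
    and act_zero: "x \<in> space M \<Longrightarrow> act 0 x = x"
    and act_add: "x \<in> space M \<Longrightarrow> act (g + h) x = act g (act h x)"

text \<open>The value \<open>g\<mu>(A) = \<mu>(g\<^sup>-\<^sup>1.A)\<close>.\<close>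

definition translate_emeasure ::
    "('g::group_add \<Rightarrow> 'x \<Rightarrow> 'x) \<Rightarrow> 'g \<Rightarrow> 'x measure \<Rightarrow> 'x set \<Rightarrow> ennreal" where
  "translate_emeasure act g \<mu> A = emeasure \<mu> (act (- g) ` A)"

definition conv_emeasure ::
    "('g::group_add \<Rightarrow> 'x \<Rightarrow> 'x) \<Rightarrow> 'g measure \<Rightarrow> 'x measure \<Rightarrow> 'x set \<Rightarrow> ennreal" where
  "conv_emeasure act \<theta> \<mu> A = (\<integral>\<^sup>+ g. translate_emeasure act g \<mu> A \<partial>\<theta>)"

definition invariant_measure :: "('g::group_add \<Rightarrow> 'x \<Rightarrow> 'x) \<Rightarrow> 'x measure \<Rightarrow> bool" where
  "invariant_measure act m \<longleftrightarrow>
     (\<forall>g. \<forall>A\<in>sets m. translate_emeasure act g m A = emeasure m A)"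

locale stationary_space =
  borel_G_space \<mu> act + prob_space \<mu>
  for \<theta> :: "'g::{topological_group_add, second_countable_topology, t2_space} measure"
    and \<mu> :: "'x measure" and act :: "'g \<Rightarrow> 'x \<Rightarrow> 'x" +
  assumes stationary: "A \<in> sets \<mu> \<Longrightarrow> conv_emeasure act \<theta> \<mu> A = emeasure \<mu> A"

definition ergodic_action :: "('g \<Rightarrow> 'x \<Rightarrow> 'x) \<Rightarrow> 'x measure \<Rightarrow> bool" where
  "ergodic_action act \<mu> \<longleftrightarrow>
     (\<forall>f::'x \<Rightarrow> real. f \<in> borel_measurable \<mu> \<longrightarrow>
        (\<forall>g. AE x in \<mu>. f (act g x) = f x) \<longrightarrow> (\<exists>c. AE x in \<mu>. f x = c))"

definition type_III :: "('g::group_add \<Rightarrow> 'x \<Rightarrow> 'x) \<Rightarrow> 'x measure \<Rightarrow> bool" where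
  "type_III act \<mu> \<longleftrightarrow>
     \<not> (\<exists>m. sets m = sets \<mu> \<and> emeasure m (space m) \<noteq> 0 \<and> sigma_finite_measure m \<and>
            invariant_measure act m \<and> absolutely_continuous \<mu> m)"

end

theory Submission
  imports Defs
begin

text \<open>
  Let \<open>m = F\<mu>\<close> be invariant. For \<open>c > 0\<close> the measure \<open>\<mu> \<and> cm\<close> with density \<open>min 1 (cF)\<close> is
  stationary, because convolution by \<open>\<theta>\<close> maps it below itself and preserves its total mass. The
  difference \<open>\<mu> - \<mu> \<and> cm\<close> is then stationary too, and it lives exactly on \<open>{F < 1/c}\<close>. Null sets of
  a finite stationary measure are preserved by every \<open>g\<close>, so \<open>F(gx) < 1/c\<close> for almost every \<open>x\<close> with
  \<open>F(x) < 1/c\<close>. Hence \<open>F(gx) = F(x)\<close> almost everywhere, \<open>F\<close> is constant by ergodicity, and \<open>\<mu>\<close> is a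
  multiple of \<open>m\<close>.

  Preservation of null sets rests on the Steinhaus property of Haar measure: for a null set \<open>B\<close> the
  set of \<open>g\<close> with \<open>g\<nu>(B) = 0\<close> contains \<open>0\<close>, is closed, and is stable under right translation by
  almost every element of \<open>G\<close>.
\<close>

section \<open>Translates of sets and the Steinhaus property of Haar measure\<close>

lemma plus_image_eq_vimage: "(+) g ` A = (+) (- g) -` A" for g :: "'g::group_add"
proof (intro equalityI subsetI)
  fix x assume "x \<in> (+) (- g) -` A"
  then show "x \<in> (+) g ` A"
    by (intro image_eqI[of _ _ "- g + x"]) auto
qed auto

lemma continuous_on_plus_left: "continuous_on S ((+) g)"
  for g :: "'g::topological_monoid_add"
  by (intro continuous_intros)

lemma sets_borel_plus_image:
  "A \<in> sets borel \<Longrightarrow> (+) g ` A \<in> sets borel" for g :: "'g::topological_group_add"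
  using measurable_sets[OF borel_measurable_continuous_onI[OF continuous_on_plus_left, of "- g"], of A]
  by (simp add: plus_image_eq_vimage)

text \<open>Addition is continuous, so the pairs with sum in \<open>U\<close> form an open set
  containing \<open>{0} \<times> K\<close>; the tube lemma thickens \<open>{0}\<close> to
  \<open>V\<close>.\<close>

lemma compact_plus_subset_open:
  fixes K U :: "'g::topological_monoid_add set"
  assumes "compact K" "open U" "K \<subseteq> U"
  obtains V where "open V" "0 \<in> V" "\<And>v. v \<in> V \<Longrightarrow> (+) v ` K \<subseteq> U"
proof -
  have "open ((\<lambda>p::'g \<times> 'g. fst p + snd p) -` U)"
    by (intro open_vimage assms continuous_intros)
  then have "\<exists>V. 0 \<in> V \<and> open V \<and> V \<times> K \<subseteq> (\<lambda>p::'g \<times> 'g. fst p + snd p) -` U"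
    using assms(3) by (intro Elementary_Topology.tube_lemma[OF assms(1)]) auto
  then obtain V where V: "0 \<in> V" "open V"
      "V \<times> K \<subseteq> (\<lambda>p::'g \<times> 'g. fst p + snd p) -` U"
    by blast
  show ?thesis
    using V by (intro that[of V]) auto
qed

text \<open>Steinhaus: approximate \<open>F\<close> from outside by an open \<open>U\<close>, and \<open>U\<close> from inside by a compact
  \<open>K\<close>. Both \<open>F\<close> and \<open>v + (F \<inter> K)\<close> lie in \<open>U\<close> and together they are too large to be
  disjoint.\<close>

lemma haar_measure_translate_Int:
  fixes \<nu> :: "'g::{topological_group_add, t2_space} measure"
  assumes haar: "haar_measure \<nu>" and F: "F \<in> sets borel" "0 < emeasure \<nu> F" "emeasure \<nu> F < \<infinity>"
  obtains V where "open V" "0 \<in> V" "\<And>v. v \<in> V \<Longrightarrow> 0 < emeasure \<nu> ((+) v ` F \<inter> F)"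
proof -
  have S: "sets \<nu> = sets borel"
    and inv: "\<And>g A. A \<in> sets borel \<Longrightarrow> emeasure \<nu> ((+) g ` A) = emeasure \<nu> A"
    and outer: "emeasure \<nu> F = (INF U\<in>{U. open U \<and> F \<subseteq> U}. emeasure \<nu> U)"
    and inner: "\<And>U. open U \<Longrightarrow> emeasure \<nu> U = (SUP K\<in>{K. compact K \<and> K \<subseteq> U}. emeasure \<nu> K)"
    using haar F(1) by (auto simp: haar_measure_def)
  define a where "a = measure \<nu> F"
  have a: "emeasure \<nu> F = ennreal a" "0 < a"
    using F(2,3) by (auto simp: a_def measure_def enn2real_positive_iff)
  \<comment> \<open>The factors 5/4 and 3/4 leave room for two inclusion-exclusions inside
    \<open>U\<close>: \<open>F \<inter> K\<close> has measure above
    \<open>a + 3/4 a - 5/4 a = a/2\<close>, and then \<open>F\<close> meets the translate of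
    \<open>F \<inter> K\<close> in measure above \<open>a + a/2 - 5/4 a = a/4\<close>.\<close>
  have "(INF U\<in>{U. open U \<and> F \<subseteq> U}. emeasure \<nu> U) < ennreal (5/4 * a)"
    using a by (simp flip: outer add: ennreal_less_iff)
  then obtain U where U: "open U" "F \<subseteq> U" "emeasure \<nu> U < ennreal (5/4 * a)"
    by (auto simp: INF_less_iff)
  have "ennreal (3/4 * a) < emeasure \<nu> F"
    using a by (simp add: ennreal_less_iff)
  also have "\<dots> \<le> emeasure \<nu> U"
    using U S by (intro emeasure_mono) auto
  finally obtain K where K: "compact K" "K \<subseteq> U" "ennreal (3/4 * a) < emeasure \<nu> K"
    by (auto simp: inner[OF U(1)] less_SUP_iff)
  have KS: "K \<in> sets \<nu>" and US: "U \<in> sets \<nu>" and FS: "F \<in> sets \<nu>"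
    using S F(1) borel_closed[OF compact_imp_closed[OF K(1)]] U by auto
  obtain V where V: "open V" "0 \<in> V" "\<And>v. v \<in> V \<Longrightarrow> (+) v ` K \<subseteq> U"
    using compact_plus_subset_open[OF K(1) U(1) K(2)] by blast
  have "0 < emeasure \<nu> ((+) v ` F \<inter> F)" if v: "v \<in> V" for v
  proof -
    let ?E = "(+) v ` (F \<inter> K)"
    have ES: "?E \<in> sets \<nu>" using sets_borel_plus_image[of "F \<inter> K" v] KS FS S by auto
    have fin: "emeasure \<nu> A = ennreal (measure \<nu> A)" if "A \<subseteq> U" for A
      using emeasure_mono[OF that US] U(3)
      by (intro emeasure_eq_ennreal_measure) (auto simp: top_unique)
    have EU: "?E \<subseteq> U" using V(3)[OF v] by auto
    have 1: "measure \<nu> F + measure \<nu> K \<le> measure \<nu> U + measure \<nu> (F \<inter> K)"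
    proof -
      have "emeasure \<nu> F + emeasure \<nu> K \<le> emeasure \<nu> U + emeasure \<nu> (F \<inter> K)"
        unfolding emeasure_Un_Int[OF FS KS]
        using U K US FS KS by (intro add_mono emeasure_mono) auto
      then show ?thesis
        using fin[OF U(2)] fin[OF K(2)] fin[OF order_refl] fin[of "F \<inter> K"] K(2)
        by (simp add: ennreal_plus[symmetric] le_infI2 del: ennreal_plus)
    qed
    have 2: "measure \<nu> F + measure \<nu> ?E \<le> measure \<nu> U + measure \<nu> (F \<inter> ?E)"
    proof -
      have "emeasure \<nu> F + emeasure \<nu> ?E \<le> emeasure \<nu> U + emeasure \<nu> (F \<inter> ?E)"
        unfolding emeasure_Un_Int[OF FS ES]
        using U EU US FS ES by (intro add_mono emeasure_mono) auto
      then show ?thesis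
        using fin[OF U(2)] fin[OF EU] fin[OF order_refl] fin[of "F \<inter> ?E"] EU
        by (simp add: ennreal_plus[symmetric] le_infI2 del: ennreal_plus)
    qed
    have 3: "measure \<nu> ?E = measure \<nu> (F \<inter> K)"
      using inv[of "F \<inter> K" v] KS FS S by (auto simp: measure_def)
    have "measure \<nu> U < 5/4 * a" "3/4 * a < measure \<nu> K"
      using U(3) K(3) a(2) by (auto simp: fin[OF order_refl] fin[OF K(2)] ennreal_less_iff)
    with 1 2 3 a have "0 < measure \<nu> (F \<inter> ?E)"
      by (auto simp: a_def)
    then have "0 < emeasure \<nu> (F \<inter> ?E)"
      by (auto simp: measure_def enn2real_positive_iff)
    also have "\<dots> \<le> emeasure \<nu> ((+) v ` F \<inter> F)"
      using sets_borel_plus_image[OF F(1), of v] FS S by (intro emeasure_mono) auto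
    finally show ?thesis .
  qed
  with V show ?thesis by (intro that[of V]) auto
qed

text \<open>Each point has an open neighbourhood inside a compact set, and Lindelof leaves countably
  many of these. The cover makes \<open>\<nu>\<close> sigma-finite, so that \<open>\<theta>\<close>
  gets a density, and cuts positive sets down to finite measure.\<close>

lemma haar_measure_finite_open_cover:
  fixes \<nu> :: "'g::{topological_group_add, second_countable_topology, t2_space} measure"
  assumes lc: "locally_compact_space (euclidean :: 'g topology)" and haar: "haar_measure \<nu>"
  obtains \<U> where "countable \<U>" "\<Union>\<U> = UNIV" "\<And>U. U \<in> \<U> \<Longrightarrow> open U \<and> emeasure \<nu> U < \<infinity>"
proof -
  let ?\<F> = "{U. open U \<and> emeasure \<nu> U < \<infinity>}"
  have "x \<in> \<Union>?\<F>" for x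
  proof -
    obtain U K where UK: "open U" "compact K" "x \<in> U" "U \<subseteq> K"
      using lc[unfolded locally_compact_space_def, rule_format, of x] by auto
    have "emeasure \<nu> U \<le> emeasure \<nu> K"
      using UK haar by (intro emeasure_mono) (auto simp: haar_measure_def compact_imp_closed)
    also have "\<dots> < \<infinity>"
      using UK haar by (auto simp: haar_measure_def)
    finally show ?thesis using UK by blast
  qed
  then have cover: "\<Union>?\<F> = UNIV" by blast
  obtain \<U> where \<U>: "\<U> \<subseteq> ?\<F>" "countable \<U>" "\<Union>\<U> = \<Union>?\<F>"
    by (rule Lindelof[of ?\<F>]) simp_all
  show ?thesis
  proof (rule that)
    show "\<Union>\<U> = UNIV" using \<U>(3) cover by (rule trans)
    show "open U \<and> emeasure \<nu> U < \<infinity>" if "U \<in> \<U>" for U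
      using subsetD[OF \<U>(1) that] by simp
  qed (fact \<U>(2))
qed

text \<open>For \<open>\<theta> = f\<nu>\<close> the \<open>\<theta>\<close>-positive sets are those meeting \<open>{f > 0}\<close> in a \<open>\<nu>\<close>-positive set,
  so the Steinhaus property of \<open>\<nu>\<close> carries over.\<close>

lemma (in measured_group) translate_pos_neighbourhood:
  assumes C: "C \<in> sets borel" "0 < emeasure \<theta> C"
  obtains V where "open V" "0 \<in> V" "\<And>v. v \<in> V \<Longrightarrow> 0 < emeasure \<theta> ((+) v ` C)"
proof -
  obtain \<nu> where haar: "haar_measure \<nu>" and ac: "absolutely_continuous \<nu> \<theta>"
    using abs_cont_haar by (elim exE conjE)
  have S: "sets \<nu> = sets borel" using haar by (simp add: haar_measure_def)
  have sp: "space \<nu> = UNIV" using sets_eq_imp_space_eq[OF S] by simp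
  obtain \<U> where \<U>: "countable \<U>" "\<Union>\<U> = UNIV"
    "\<And>U. U \<in> \<U> \<Longrightarrow> open U \<and> emeasure \<nu> U < \<infinity>"
    using haar_measure_finite_open_cover[OF locally_compact haar] by blast
  interpret \<nu>: sigma_finite_measure \<nu>
  proof
    have "\<forall>U\<in>\<U>. U \<in> sets \<nu> \<and> emeasure \<nu> U \<noteq> \<infinity>"
      using \<U>(3) S by (metis borel_open less_irrefl)
    then show "\<exists>A. countable A \<and> A \<subseteq> sets \<nu> \<and> \<Union>A = space \<nu> \<and> (\<forall>a\<in>A. emeasure \<nu> a \<noteq> \<infinity>)"
      using \<U>(1,2) sp by (intro exI[of _ \<U>]) blast
  qed
  obtain f where f: "f \<in> borel_measurable \<nu>" "density \<nu> f = \<theta>"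
    using \<nu>.Radon_Nikodym[OF ac] S sets_borel by auto
  define D where "D = {x \<in> space \<nu>. 0 < f x}"
  have D: "D \<in> sets \<nu>" using f(1) by (auto simp: D_def)
  have pos_iff: "0 < emeasure \<theta> B \<longleftrightarrow> 0 < emeasure \<nu> (B \<inter> D)" if B: "B \<in> sets borel" for B
  proof -
    have "emeasure \<theta> B = 0 \<longleftrightarrow> (\<integral>\<^sup>+x. f x * indicator B x \<partial>\<nu>) = 0"
      using f B S by (simp add: emeasure_density flip: f(2))
    also have "\<dots> \<longleftrightarrow> (AE x in \<nu>. x \<notin> B \<inter> D)"
      using f B S by (subst nn_integral_0_iff_AE)
        (auto simp: D_def sp indicator_def zero_less_iff_neq_zero intro!: AE_cong)
    also have "\<dots> \<longleftrightarrow> emeasure \<nu> (B \<inter> D) = 0"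
      using B D S by (intro AE_iff_measurable) (auto simp: sp)
    finally show ?thesis by (simp add: zero_less_iff_neq_zero)
  qed
  have "0 < emeasure \<nu> (C \<inter> D)" using C pos_iff by auto
  have "\<exists>U\<in>\<U>. 0 < emeasure \<nu> (C \<inter> D \<inter> U)"
  proof (rule ccontr)
    assume "\<not> ?thesis"
    then have "C \<inter> D \<inter> U \<in> null_sets \<nu>" if "U \<in> \<U>" for U
      using that C D S \<U> by (auto simp: null_sets_def)
    then have "(\<Union>U\<in>\<U>. C \<inter> D \<inter> U) \<in> null_sets \<nu>"
      using \<U>(1) by (intro null_sets_UN')
    also have "(\<Union>U\<in>\<U>. C \<inter> D \<inter> U) = C \<inter> D" using \<U>(2) by blast
    finally show False using \<open>0 < emeasure \<nu> (C \<inter> D)\<close> by auto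
  qed
  then obtain U where U: "U \<in> \<U>" "0 < emeasure \<nu> (C \<inter> D \<inter> U)" by blast
  define F where "F = C \<inter> D \<inter> U"
  have F: "F \<in> sets borel" "0 < emeasure \<nu> F"
    using U C D S \<U> by (auto simp: F_def)
  have "emeasure \<nu> F \<le> emeasure \<nu> U"
    using \<U>(3)[OF U(1)] S by (intro emeasure_mono) (auto simp: F_def)
  also have "\<dots> < \<infinity>" using \<U> U by auto
  finally obtain V where V: "open V" "0 \<in> V" "\<And>v. v \<in> V \<Longrightarrow> 0 < emeasure \<nu> ((+) v ` F \<inter> F)"
    using haar_measure_translate_Int[OF haar F] by blast
  have "0 < emeasure \<theta> ((+) v ` C)" if "v \<in> V" for v
  proof -
    have B: "(+) v ` C \<in> sets borel" using C(1) by (rule sets_borel_plus_image)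
    have "0 < emeasure \<nu> ((+) v ` F \<inter> F)" using V that by blast
    also have "\<dots> \<le> emeasure \<nu> ((+) v ` C \<inter> D)"
      using B D S by (intro emeasure_mono) (auto simp: F_def)
    finally show ?thesis using pos_iff[OF B] by blast
  qed
  with V show ?thesis by (intro that[of V]) auto
qed

section \<open>Closed sets of full measure\<close>

text \<open>The family may be uncountable, but by Lindelof countably many of the open complements
  already cover the union of all of them.\<close>

lemma AE_in_Inter_closed:
  fixes \<F> :: "'a::second_countable_topology set set"
  assumes S: "sets M = sets borel"
    and \<F>: "\<And>C. C \<in> \<F> \<Longrightarrow> closed C" "\<And>C. C \<in> \<F> \<Longrightarrow> AE x in M. x \<in> C"
  shows "AE x in M. x \<in> \<Inter>\<F>"
proof -
  obtain \<G> where \<G>: "\<G> \<subseteq> uminus ` \<F>" "countable \<G>" "\<Union>\<G> = \<Union>(uminus ` \<F>)"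
    using Lindelof[of "uminus ` \<F>"] \<F>(1) by auto
  have "AE x in M. \<forall>U\<in>\<G>. x \<notin> U"
    using \<G> \<F>(2) by (subst AE_ball_countable) auto
  then show ?thesis
    by (rule eventually_mono) (use \<G>(3) in blast)
qed

text \<open>The stabiliser \<open>{h. Z + h \<subseteq> Z}\<close> is a closed semigroup of full \<open>\<theta>\<close>-measure.\<close>

lemma (in measured_group) closed_absorbing_eq_UNIV:
  assumes Z: "closed Z" "0 \<in> Z" "\<And>g. g \<in> Z \<Longrightarrow> AE h in \<theta>. g + h \<in> Z"
  shows "Z = UNIV"
proof -
  define S where "S = (\<Inter>z\<in>Z. (+) z -` Z)"
  have cl: "closed ((+) z -` Z)" for z
    using Z(1) by (intro closed_vimage continuous_on_plus_left)
  have "closed S" using cl by (auto simp: S_def)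
  moreover have "subsemigroup S"
    by (auto simp: S_def subsemigroup_def simp flip: add.assoc)
  moreover have "AE g in \<theta>. g \<in> S"
    unfolding S_def using cl Z(3) by (intro AE_in_Inter_closed sets_borel) auto
  ultimately have "S = UNIV" using not_supported_on_proper_subsemigroup by blast
  \<comment> \<open>As \<open>0 \<in> Z\<close>, each \<open>s \<in> S\<close> gives
    \<open>0 + s \<in> Z\<close>, so \<open>S \<subseteq> Z\<close>.\<close>
  then show ?thesis
    using Z(2) by (metis (no_types, lifting) INT_iff S_def UNIV_I UNIV_eq_I add_0_left vimage_eq)
qed

section \<open>Borel actions, null sets of stationary measures, and convolution\<close>

context borel_G_space
begin

lemma act_in_space: "x \<in> space M \<Longrightarrow> act g x \<in> space M"
  using measurable_space[OF act_measurable, of "(g, x)"] by (simp add: space_pair_measure)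

lemma measurable_act: "act g \<in> M \<rightarrow>\<^sub>M M"
  using measurable_compose[OF measurable_Pair1'[of g borel M] act_measurable] by simp

lemma act_uminus_act: "x \<in> space M \<Longrightarrow> act (- g) (act g x) = x"
  by (simp flip: act_add add: act_zero)

lemma act_act_uminus: "x \<in> space M \<Longrightarrow> act g (act (- g) x) = x"
  by (simp flip: act_add add: act_zero)

text \<open>Turns the images that define translated measures into preimages, which are measurable
  and respect disjointness.\<close>

lemma act_image_eq_vimage:
  assumes "A \<subseteq> space M"
  shows "act (- g) ` A = {x \<in> space M. act g x \<in> A}"
proof (intro equalityI subsetI)
  fix x assume "x \<in> act (- g) ` A"
  then show "x \<in> {x \<in> space M. act g x \<in> A}"
    using assms by (auto simp: act_act_uminus intro: act_in_space)
next
  fix x assume "x \<in> {x \<in> space M. act g x \<in> A}"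
  then show "x \<in> act (- g) ` A"
    by (intro image_eqI[of _ _ "act g x"]) (auto simp: act_uminus_act)
qed

lemma act_image_space: "act (- g) ` space M = space M"
  by (auto simp: act_image_eq_vimage act_in_space)

lemma sets_act_image: "A \<in> sets M \<Longrightarrow> act (- g) ` A \<in> sets M"
  using measurable_sets[OF measurable_act, of A g] sets.sets_into_space[of A M]
  by (simp add: act_image_eq_vimage vimage_def Int_def conj_commute)

lemma act_image_add:
  assumes "A \<subseteq> space M"
  shows "act (- h) ` act (- g) ` A = act (- (g + h)) ` A"
  using assms by (auto simp: image_image minus_add subset_iff simp flip: act_add intro!: image_cong)

lemma borel_measurable_translate_emeasure:
  assumes "finite_measure \<nu>" "sets \<nu> = sets M" "A \<in> sets M"
  shows "(\<lambda>g. translate_emeasure act g \<nu> A) \<in> borel_measurable borel"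
proof -
  interpret \<nu>: finite_measure \<nu> by fact
  have sp: "space \<nu> = space M" using assms(2) by (rule sets_eq_imp_space_eq)
  let ?Q = "(\<lambda>(g, x). act g x) -` A \<inter> space (borel \<Otimes>\<^sub>M M)"
  have "?Q \<in> sets (borel \<Otimes>\<^sub>M M)"
    using act_measurable assms(3) by (rule measurable_sets)
  also have "sets (borel \<Otimes>\<^sub>M M) = sets (borel \<Otimes>\<^sub>M \<nu>)"
    using assms(2) by (intro sets_pair_measure_cong) auto
  finally have "(\<lambda>g. emeasure \<nu> (Pair g -` ?Q)) \<in> borel_measurable borel"
    by (rule \<nu>.measurable_emeasure_Pair)
  \<comment> \<open>The section at \<open>g\<close> of the preimage of \<open>A\<close> under the
    action map is the set of \<open>x\<close> with \<open>act g x \<in> A\<close>.\<close>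
  also have "(\<lambda>g. emeasure \<nu> (Pair g -` ?Q)) = (\<lambda>g. translate_emeasure act g \<nu> A)"
    using sets.sets_into_space[OF assms(3)]
    by (intro ext arg_cong[where f="emeasure \<nu>"])
      (auto simp: translate_emeasure_def act_image_eq_vimage space_pair_measure
        intro!: arg_cong[where f="emeasure \<nu>"])
  finally show ?thesis .
qed

text \<open>\<open>P = {g. g\<nu>(B) > 0}\<close> satisfies \<open>g \<in> P\<close> iff \<open>\<theta>(-g + P) > 0\<close> by stationarity, so it is
  open by the Steinhaus property, and its complement is absorbing.\<close>

lemma stationary_translate_null:
  assumes \<theta>: "measured_group \<theta>" and \<nu>: "finite_measure \<nu>" "sets \<nu> = sets M"
    and stat: "\<And>A. A \<in> sets M \<Longrightarrow> conv_emeasure act \<theta> \<nu> A = emeasure \<nu> A"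
    and B: "B \<in> sets M" "emeasure \<nu> B = 0"
  shows "translate_emeasure act g \<nu> B = 0"
proof -
  interpret measured_group \<theta> by fact
  have BS: "B \<subseteq> space M" using B(1) by (rule sets.sets_into_space)
  define \<phi> where "\<phi> g = translate_emeasure act g \<nu> B" for g
  have \<phi>_meas: "\<phi> \<in> borel_measurable borel"
    unfolding \<phi>_def by (intro borel_measurable_translate_emeasure \<nu> B)
  define P where "P = {g. 0 < \<phi> g}"
  have P: "P \<in> sets borel"
    using measurable_sets[OF \<phi>_meas, of "{0<..}"] by (simp add: P_def vimage_def)
  \<comment> \<open>Stationarity is applied to the translate of \<open>B\<close> by
    \<open>- g\<close>; translating again by \<open>- h\<close> gives the translate by
    \<open>- (g + h)\<close>.\<close>
  have \<phi>_harmonic: "\<phi> g = (\<integral>\<^sup>+h. \<phi> (g + h) \<partial>\<theta>)" for g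
    using stat[OF sets_act_image[OF B(1), of g]]
    by (simp add: conv_emeasure_def translate_emeasure_def \<phi>_def act_image_add[OF BS])
  have vim: "(+) (- g) ` P = (+) g -` P" for g
    by (simp add: plus_image_eq_vimage)
  have shift: "(+) (- g) ` P \<in> sets \<theta>" for g
    using sets_borel_plus_image[OF P] sets_borel by simp
  have meas: "(\<lambda>h. \<phi> (g + h)) \<in> borel_measurable \<theta>" for g
    using measurable_compose[OF borel_measurable_continuous_onI[OF continuous_on_plus_left] \<phi>_meas]
    by (simp add: measurable_cong_sets[OF sets_borel refl])
  have notin_P: "g \<notin> P \<longleftrightarrow> (AE h in \<theta>. g + h \<notin> P)" for g
  proof -
    have "g \<notin> P \<longleftrightarrow> (\<integral>\<^sup>+h. \<phi> (g + h) \<partial>\<theta>) = 0"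
      using \<phi>_harmonic[of g] by (simp add: P_def zero_less_iff_neq_zero)
    also have "\<dots> \<longleftrightarrow> (AE h in \<theta>. g + h \<notin> P)"
      using meas by (simp add: nn_integral_0_iff_AE P_def zero_less_iff_neq_zero)
    finally show ?thesis .
  qed
  have in_P: "g \<in> P \<longleftrightarrow> 0 < emeasure \<theta> ((+) (- g) ` P)" for g
  proof -
    have "(AE h in \<theta>. g + h \<notin> P) \<longleftrightarrow> emeasure \<theta> ((+) (- g) ` P) = 0"
      using sets_eq_imp_space_eq[OF sets_borel]
      by (intro AE_iff_measurable shift) (auto simp: vim)
    then show ?thesis using notin_P[of g] by (auto simp: zero_less_iff_neq_zero)
  qed
  have "open P"
  proof (subst open_subopen, intro ballI)
    fix g assume "g \<in> P"
    then have pos: "0 < emeasure \<theta> ((+) (- g) ` P)" using in_P by blast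
    obtain V where V: "open V" "0 \<in> V" "\<And>v. v \<in> V \<Longrightarrow> 0 < emeasure \<theta> ((+) v ` (+) (- g) ` P)"
      using translate_pos_neighbourhood[OF sets_borel_plus_image[OF P] pos] by blast
    \<comment> \<open>For \<open>v = - g' + g\<close> in \<open>V\<close>, translating
      \<open>- g + P\<close> by \<open>v\<close> yields \<open>- g' + P\<close>, so positivity
      passes from \<open>g\<close> to \<open>g'\<close>.\<close>
    let ?W = "(\<lambda>g'. - g' + g) -` V"
    have "open ?W"
      using V(1) by (intro open_vimage continuous_intros)
    moreover have "?W \<subseteq> P"
    proof
      fix g' assume "g' \<in> ?W"
      then have "0 < emeasure \<theta> ((+) (- g' + g) ` (+) (- g) ` P)" using V(3) by simp
      also have "(+) (- g' + g) ` (+) (- g) ` P = (+) (- g') ` P"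
        by (simp add: image_image add.assoc)
      finally show "g' \<in> P" using in_P by blast
    qed
    ultimately show "\<exists>T. open T \<and> g \<in> T \<and> T \<subseteq> P"
      using V(2) by (intro exI[of _ ?W]) simp
  qed
  have "act 0 ` B = B"
    using BS by (force simp: act_zero image_iff)
  then have "0 \<notin> P"
    using B(2) by (simp add: P_def \<phi>_def translate_emeasure_def)
  have "- P = UNIV"
  proof (rule closed_absorbing_eq_UNIV)
    show "AE h in \<theta>. g + h \<in> - P" if "g \<in> - P" for g
      using that notin_P[of g] by simp
  qed (use \<open>open P\<close> \<open>0 \<notin> P\<close> in \<open>simp_all add: closed_Compl\<close>)
  then show ?thesis
    by (auto simp: P_def \<phi>_def zero_less_iff_neq_zero)
qed

lemma conv_emeasure_Un:
  assumes "prob_space \<theta>" "sets \<theta> = sets borel" "finite_measure \<nu>" "sets \<nu> = sets M"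
    and "A \<in> sets M" "B \<in> sets M" "A \<inter> B = {}"
  shows "conv_emeasure act \<theta> \<nu> (A \<union> B) = conv_emeasure act \<theta> \<nu> A + conv_emeasure act \<theta> \<nu> B"
proof -
  have meas: "(\<lambda>g. translate_emeasure act g \<nu> C) \<in> borel_measurable \<theta>" if "C \<in> sets M" for C
    using borel_measurable_translate_emeasure[OF assms(3,4) that]
    by (simp add: measurable_cong_sets[OF assms(2) refl])
  have "translate_emeasure act g \<nu> (A \<union> B) = translate_emeasure act g \<nu> A + translate_emeasure act g \<nu> B"
    for g
  proof -
    have "act (- g) ` A \<inter> act (- g) ` B = {}"
      using sets.sets_into_space[OF assms(5)] sets.sets_into_space[OF assms(6)] assms(7)
      by (auto simp: act_image_eq_vimage)
    then show ?thesis
      using sets_act_image[OF assms(5), of g] sets_act_image[OF assms(6), of g] assms(4)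
      by (simp add: translate_emeasure_def image_Un plus_emeasure)
  qed
  then show ?thesis
    using meas assms by (simp add: conv_emeasure_def nn_integral_add)
qed

lemma conv_emeasure_space:
  assumes "prob_space \<theta>"
  shows "conv_emeasure act \<theta> \<nu> (space M) = emeasure \<nu> (space M)"
  using prob_space.emeasure_space_1[OF assms]
  by (simp add: conv_emeasure_def translate_emeasure_def act_image_space)

text \<open>Convolution preserves the total mass, so a strict drop on \<open>A\<close> would have to
  be offset by a gain on the complement, where the inequality holds too. Finiteness of
  \<open>\<nu>\<close> permits the cancellation.\<close>

lemma conv_emeasure_eq_of_le:
  assumes \<theta>: "prob_space \<theta>" "sets \<theta> = sets borel" and \<nu>: "finite_measure \<nu>" "sets \<nu> = sets M"
    and le: "\<And>A. A \<in> sets M \<Longrightarrow> conv_emeasure act \<theta> \<nu> A \<le> emeasure \<nu> A"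
    and A: "A \<in> sets M"
  shows "conv_emeasure act \<theta> \<nu> A = emeasure \<nu> A"
proof (rule antisym[OF le[OF A]])
  interpret \<nu>: finite_measure \<nu> by fact
  let ?C = "space M - A"
  have C: "?C \<in> sets M" using A by auto
  have un: "A \<union> ?C = space M" using sets.sets_into_space[OF A] by auto
  have "emeasure \<nu> A + emeasure \<nu> ?C = emeasure \<nu> (space M)"
    using A C \<nu>(2) un by (subst plus_emeasure) auto
  also have "\<dots> = conv_emeasure act \<theta> \<nu> A + conv_emeasure act \<theta> \<nu> ?C"
    using conv_emeasure_Un[OF \<theta> \<nu> A C, unfolded un] by (simp add: conv_emeasure_space[OF \<theta>(1)])
  also have "\<dots> \<le> conv_emeasure act \<theta> \<nu> A + emeasure \<nu> ?C"
    by (intro add_left_mono le C)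
  finally show "emeasure \<nu> A \<le> conv_emeasure act \<theta> \<nu> A"
    by (simp add: ennreal_add_left_cancel_le add.commute[of _ "emeasure \<nu> ?C"])
qed

end

section \<open>Invariance of the density of an invariant measure\<close>

lemma (in stationary_space) density_sublevel_invariant:
  assumes \<theta>: "measured_group \<theta>"
    and F: "F \<in> borel_measurable \<mu>" "\<And>x. 0 \<le> F x"
    and inv: "invariant_measure act (density \<mu> (\<lambda>x. ennreal (F x)))" and c: "0 < c"
  shows "AE x in \<mu>. c * F x < 1 \<longrightarrow> c * F (act g x) < 1"
proof -
  interpret \<theta>: measured_group \<theta> by fact
  define m where "m = density \<mu> (\<lambda>x. ennreal (F x))"
  \<comment> \<open>\<open>\<eta>\<close> is the minimum of \<open>\<mu>\<close> and
    \<open>c m\<close>, and \<open>\<nu>\<close> is the remainder \<open>\<mu> - \<eta>\<close>. On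
    \<open>B\<close> the minimum is \<open>\<mu>\<close>, off \<open>B\<close> it is
    \<open>c m\<close>.\<close>
  define \<eta> where "\<eta> = density \<mu> (\<lambda>x. ennreal (min 1 (c * F x)))"
  define \<nu> where "\<nu> = density \<mu> (\<lambda>x. ennreal (1 - min 1 (c * F x)))"
  define B where "B = {x \<in> space \<mu>. 1 \<le> c * F x}"
  note [measurable] = F(1)
  have B [measurable]: "B \<in> sets \<mu>" by (simp add: B_def)
  have sets_eq: "sets m = sets \<mu>" "sets \<eta> = sets \<mu>" "sets \<nu> = sets \<mu>"
    by (simp_all add: m_def \<eta>_def \<nu>_def)
  have em: "emeasure m A = (\<integral>\<^sup>+x. ennreal (F x) * indicator A x \<partial>\<mu>)"
    and e\<eta>: "emeasure \<eta> A = (\<integral>\<^sup>+x. ennreal (min 1 (c * F x)) * indicator A x \<partial>\<mu>)"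
    and e\<nu>: "emeasure \<nu> A = (\<integral>\<^sup>+x. ennreal (1 - min 1 (c * F x)) * indicator A x \<partial>\<mu>)"
    if "A \<in> sets \<mu>" for A
    using that by (simp_all add: m_def \<eta>_def \<nu>_def emeasure_density)
  have cm: "ennreal c * emeasure m A = (\<integral>\<^sup>+x. ennreal (c * F x) * indicator A x \<partial>\<mu>)"
    if [measurable]: "A \<in> sets \<mu>" for A
    using c F(2) by (simp add: em ennreal_mult mult.assoc flip: nn_integral_cmult)
  have \<eta>_le_\<mu>: "emeasure \<eta> A \<le> emeasure \<mu> A" if [measurable]: "A \<in> sets \<mu>" for A
    by (subst nn_integral_indicator[symmetric, OF that], subst e\<eta>[OF that], intro nn_integral_mono)
      (auto simp: indicator_def)
  have \<eta>_le_cm: "emeasure \<eta> A \<le> ennreal c * emeasure m A" if [measurable]: "A \<in> sets \<mu>" for A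
    by (subst cm[OF that], subst e\<eta>[OF that], intro nn_integral_mono)
      (auto simp: indicator_def intro!: ennreal_leI)
  have \<eta>_eq_\<mu>: "emeasure \<eta> (A \<inter> B) = emeasure \<mu> (A \<inter> B)" if [measurable]: "A \<in> sets \<mu>" for A
    by (subst nn_integral_indicator[symmetric], simp, subst e\<eta>, simp, intro nn_integral_cong)
      (auto simp: indicator_def B_def)
  have \<eta>_eq_cm: "emeasure \<eta> (A - B) = ennreal c * emeasure m (A - B)"
    if [measurable]: "A \<in> sets \<mu>" for A
    using sets.sets_into_space[OF that]
    by (subst cm, simp, subst e\<eta>, simp, intro nn_integral_cong)
      (auto simp: indicator_def B_def min_def)
  have sum: "emeasure \<mu> A = emeasure \<eta> A + emeasure \<nu> A" if [measurable]: "A \<in> sets \<mu>" for A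
  proof -
    have "ennreal (min 1 (c * F x)) + ennreal (1 - min 1 (c * F x)) = 1" for x
      using c F(2)[of x] by (subst ennreal_plus[symmetric]) auto
    then show ?thesis
      by (simp add: e\<eta> e\<nu> flip: nn_integral_add distrib_right)
  qed
  have fin_\<eta>: "finite_measure \<eta>"
    using \<eta>_le_\<mu>[OF sets.top] emeasure_finite[of "space \<mu>"]
    by (intro finite_measureI) (auto simp: \<eta>_def top_unique)
  have fin_\<nu>: "finite_measure \<nu>"
    using sum[OF sets.top] emeasure_finite[of "space \<mu>"]
    by (intro finite_measureI) (auto simp: \<nu>_def)
  interpret \<eta>: finite_measure \<eta> by (rule fin_\<eta>)
  \<comment> \<open>Each piece of \<open>A\<close> uses the bound on \<open>\<eta>\<close> that is
    sharp there: \<open>\<mu>\<close> with its stationarity on \<open>A \<inter> B\<close>, and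
    \<open>c m\<close> with its invariance on \<open>A - B\<close>.\<close>
  have "conv_emeasure act \<theta> \<eta> A \<le> emeasure \<eta> A" if A [measurable]: "A \<in> sets \<mu>" for A
  proof -
    have AB: "A \<inter> B \<in> sets \<mu>" "A - B \<in> sets \<mu>" by simp_all
    have "conv_emeasure act \<theta> \<eta> A = conv_emeasure act \<theta> \<eta> ((A \<inter> B) \<union> (A - B))"
      by (simp add: Int_Diff_Un)
    also have "\<dots> = conv_emeasure act \<theta> \<eta> (A \<inter> B) + conv_emeasure act \<theta> \<eta> (A - B)"
      by (intro conv_emeasure_Un \<theta>.prob_space_axioms \<theta>.sets_borel fin_\<eta> sets_eq AB) auto
    also have "conv_emeasure act \<theta> \<eta> (A \<inter> B) \<le> conv_emeasure act \<theta> \<mu> (A \<inter> B)"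
      unfolding conv_emeasure_def translate_emeasure_def
      by (intro nn_integral_mono \<eta>_le_\<mu> sets_act_image AB)
    also have "conv_emeasure act \<theta> \<mu> (A \<inter> B) = emeasure \<eta> (A \<inter> B)"
      using stationary[OF AB(1)] \<eta>_eq_\<mu>[OF A] by simp
    also have "conv_emeasure act \<theta> \<eta> (A - B) \<le> (\<integral>\<^sup>+g. ennreal c * translate_emeasure act g m (A - B) \<partial>\<theta>)"
      unfolding conv_emeasure_def translate_emeasure_def
      by (intro nn_integral_mono \<eta>_le_cm sets_act_image AB)
    also have "\<dots> = (\<integral>\<^sup>+g. ennreal c * emeasure m (A - B) \<partial>\<theta>)"
      using inv AB(2) unfolding invariant_measure_def m_def by simp
    also have "\<dots> = emeasure \<eta> (A - B)"
      using \<eta>_eq_cm[OF A] \<theta>.emeasure_space_1 by simp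
    also have "emeasure \<eta> (A \<inter> B) + emeasure \<eta> (A - B) = emeasure \<eta> A"
      using AB sets_eq by (subst plus_emeasure) (auto simp: Int_Diff_Un)
    finally show ?thesis by (simp add: add_mono)
  qed
  then have stat_\<eta>: "conv_emeasure act \<theta> \<eta> A = emeasure \<eta> A" if "A \<in> sets \<mu>" for A
    using that by (intro conv_emeasure_eq_of_le \<theta>.prob_space_axioms \<theta>.sets_borel fin_\<eta> sets_eq)
  have stat_\<nu>: "conv_emeasure act \<theta> \<nu> A = emeasure \<nu> A" if A: "A \<in> sets \<mu>" for A
  proof -
    have "conv_emeasure act \<theta> \<mu> A = conv_emeasure act \<theta> \<eta> A + conv_emeasure act \<theta> \<nu> A"
      using borel_measurable_translate_emeasure[OF fin_\<eta> sets_eq(2) A]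
        borel_measurable_translate_emeasure[OF fin_\<nu> sets_eq(3) A]
      unfolding conv_emeasure_def
      by (subst nn_integral_add[symmetric])
        (auto simp: translate_emeasure_def sum sets_act_image[OF A]
          measurable_cong_sets[OF \<theta>.sets_borel refl])
    then have "emeasure \<eta> A + conv_emeasure act \<theta> \<nu> A = emeasure \<eta> A + emeasure \<nu> A"
      using stationary[OF A] sum[OF A] stat_\<eta>[OF A] by simp
    then show ?thesis
      by (simp add: ennreal_add_left_cancel)
  qed
  have "emeasure \<nu> B = (\<integral>\<^sup>+x. 0 \<partial>\<mu>)"
    unfolding e\<nu>[OF B] by (intro nn_integral_cong) (auto simp: indicator_def B_def)
  then have "emeasure \<nu> B = 0" by simp
  from stationary_translate_null[OF \<theta> fin_\<nu> sets_eq(3) stat_\<nu> B this]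
  have "emeasure \<nu> (act (- g) ` B) = 0" by (simp add: translate_emeasure_def)
  \<comment> \<open>Almost every \<open>x\<close> with \<open>act g x \<in> B\<close> has vanishing
    \<open>\<nu>\<close>-density, that is \<open>1 \<le> c * F x\<close>; the claim is the
    contrapositive.\<close>
  then have "AE x in \<mu>. ennreal (1 - min 1 (c * F x)) * indicator (act (- g) ` B) x = 0"
    using sets_act_image[OF B, of g] by (simp add: e\<nu> nn_integral_0_iff_AE)
  then show ?thesis
    using AE_space
  proof eventually_elim
    case (elim x)
    have "B \<subseteq> space \<mu>" by (auto simp: B_def)
    with elim show ?case
      by (auto simp: act_image_eq_vimage indicator_def ennreal_eq_0_iff B_def act_in_space
        split: if_splits)
  qed
qed

text \<open>Sublevel sets at all positive rational heights give \<open>F (act g x) \<le> F x\<close>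
  almost everywhere; the same bound for \<open>- g\<close>, read at the point
  \<open>act g x\<close>, gives the reverse.\<close>

lemma (in stationary_space) density_invariant:
  assumes \<theta>: "measured_group \<theta>"
    and F: "F \<in> borel_measurable \<mu>" "\<And>x. 0 \<le> F x"
    and inv: "invariant_measure act (density \<mu> (\<lambda>x. ennreal (F x)))"
  shows "AE x in \<mu>. F (act g x) = F x"
proof -
  note [measurable] = F(1) measurable_act
  have le: "AE x in \<mu>. F (act g x) \<le> F x" for g
  proof -
    \<comment> \<open>Taking \<open>c = inverse q\<close> makes the sublevel set
      \<open>F x < q\<close>. Restricting to rationals keeps the exceptional set null.\<close>
    have "AE x in \<mu>. \<forall>q\<in>{q\<in>\<rat>. 0 < q}. inverse q * F x < 1 \<longrightarrow> inverse q * F (act g x) < 1"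
      using density_sublevel_invariant[OF \<theta> F inv] countable_rat
      by (subst AE_ball_countable) (auto intro: countable_subset[of _ \<rat>])
    then show ?thesis
    proof eventually_elim
      case (elim x)
      show ?case
      proof (rule ccontr)
        assume "\<not> ?thesis"
        then obtain q where q: "q \<in> \<rat>" "F x < q" "q < F (act g x)"
          using Rats_dense_in_real[of "F x" "F (act g x)"] by auto
        with F(2)[of x] have "0 < q" by linarith
        with q elim show False by (force simp: field_simps)
      qed
    qed
  qed
  \<comment> \<open>Reading the bound for \<open>- g\<close> at \<open>act g x\<close> requires that
    the preimage of its exceptional set \<open>N\<close> under \<open>act g\<close> be null; this
    holds as \<open>\<mu>\<close> itself is stationary.\<close>
  define N where "N = {x \<in> space \<mu>. \<not> F (act (- g) x) \<le> F x}"
  have N: "N \<in> sets \<mu>" unfolding N_def by measurable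
  have "emeasure \<mu> N = 0"
    using le[of "- g"] N unfolding N_def by (intro AE_iff_measurable[THEN iffD1]) auto
  from stationary_translate_null[OF \<theta> finite_measure_axioms refl stationary N this, of g]
  have "act (- g) ` N \<in> null_sets \<mu>"
    using sets_act_image[OF N, of g] by (simp add: translate_emeasure_def null_sets_def)
  from AE_not_in[OF this] le[of g] AE_space show ?thesis
  proof eventually_elim
    case (elim x)
    have "N \<subseteq> space \<mu>" by (auto simp: N_def)
    with elim show ?case
      by (auto simp: act_image_eq_vimage N_def act_in_space act_uminus_act)
  qed
qed

theorem theorem1p2:
  fixes \<theta> :: "'g::{topological_group_add, second_countable_topology, t2_space} measure"
    and \<mu> :: "'x measure" and act :: "'g \<Rightarrow> 'x \<Rightarrow> 'x"
  assumes "measured_group \<theta>"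
    and "stationary_space \<theta> \<mu> act"
    and "ergodic_action act \<mu>"
  shows "invariant_measure act \<mu> \<or> type_III act \<mu>"
proof (rule disjCI)
  interpret stationary_space \<theta> \<mu> act by fact
  assume "\<not> type_III act \<mu>"
  then obtain m where m: "sets m = sets \<mu>" "emeasure m (space m) \<noteq> 0" "sigma_finite_measure m"
    "invariant_measure act m" "absolutely_continuous \<mu> m"
    by (auto simp: type_III_def)
  \<comment> \<open>\<open>enn2real\<close> sends the value infinity to 0, which changes the
    derivative only on a null set since \<open>m\<close> is sigma-finite.\<close>
  define F where "F x = enn2real (RN_deriv \<mu> m x)" for x
  have F: "F \<in> borel_measurable \<mu>" "\<And>x. 0 \<le> F x" unfolding F_def by simp_all
  have "density \<mu> (\<lambda>x. ennreal (F x)) = density \<mu> (RN_deriv \<mu> m)"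
    using RN_deriv_finite[OF m(3,5,1)]
    by (intro density_cong) (auto simp: F_def top.not_eq_extremum elim!: eventually_mono)
  also have "\<dots> = m" using m(5,1) by (rule density_RN_deriv)
  finally have m_eq: "m = density \<mu> (\<lambda>x. ennreal (F x))" ..
  have "\<forall>g. AE x in \<mu>. F (act g x) = F x"
    using density_invariant[OF assms(1) F] m(4) m_eq by blast
  with assms(3) F(1) obtain c where c: "AE x in \<mu>. F x = c"
    unfolding ergodic_action_def by blast
  have "m = density \<mu> (\<lambda>x. ennreal c)"
    unfolding m_eq using c F(1) by (intro density_cong) (auto elim!: eventually_mono)
  then have em: "emeasure m A = ennreal c * emeasure \<mu> A" if "A \<in> sets \<mu>" for A
    using that by (simp add: emeasure_density_const)
  \<comment> \<open>\<open>ennreal\<close> sends nonpositive reals to 0, so a nonzero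
    \<open>m\<close> forces \<open>c > 0\<close>, and the finite factor \<open>ennreal c\<close> can
    be cancelled at the end.\<close>
  have c0: "ennreal c \<noteq> 0"
    using m(2) em[OF sets.top] sets_eq_imp_space_eq[OF m(1)] by auto
  show "invariant_measure act \<mu>"
    unfolding invariant_measure_def translate_emeasure_def
  proof (intro allI ballI)
    fix g A assume A: "A \<in> sets \<mu>"
    have "emeasure m (act (- g) ` A) = emeasure m A"
      using m(1,4) A by (simp add: invariant_measure_def translate_emeasure_def)
    then have "ennreal c * emeasure \<mu> (act (- g) ` A) = ennreal c * emeasure \<mu> A"
      using em[OF A] em[OF sets_act_image[OF A]] by simp
    then show "emeasure \<mu> (act (- g) ` A) = emeasure \<mu> A"
      using c0 by (simp add: ennreal_mult_cancel_left)
  qed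
qed

end
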